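(* Let $(a,\rho,p)$ with $a(t)>0$ be a solution on $[t_0,\infty)$, $t_0>0$, of the Friedmann equations with curvature index $k=0$: $$\left(\frac{\dot a}{a}\right)^2=\frac{8\pi G}{3}\rho,\qquad \frac{\ddot a}{a}=-\frac{4\pi G}{3}\left(\rho+\frac{3p}{c^2}\right),\qquad \dot\rho+3\frac{\dot a}{a}\left(\rho+\frac{p}{c^2}\right)=0.$$ Let $\mu(t)=\frac{4\pi G}{3}t^2\left(\rho+\frac{3p}{c^2}\right)$ and assume $\mu\in\mathcal M_\Gamma$ with $\Gamma<1/4$. Let $a(t)=t^\alpha L(t)$ with $\alpha\ne0$ and $L\in\mathcal N$, and put $w=\frac{2}{3\alpha}-1$. Then there are $\xi,\zeta\in\mathcal Z_0$ such that, for all sufficiently large $t$, $$p=\hat w\,\rho c^2,\qquad\text{where } \hat w(t)=w-t\dot\xi(t)+\zeta(t).$$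
   Context: $G,c>0$ are constants. All functions are real-valued and continuous with sufficiently many derivatives (at least, $a$ has a continuous second derivative). $\mathcal Z_0$ is the class of functions $\varepsilon$ with $\lim_{t\to+\infty}\varepsilon(t)=0$ (those that are differentiated are differentiable). $\mathcal N$ is the class of normalized slowly varying functions: $L\in\mathcal N$ iff there are a constant $h>0$, a number $b>0$ and $\varepsilon\in\mathcal Z_0$ with $L(x)=h\exp\left(\int_b^x\frac{\varepsilon(t)}{t}\,dt\right)$ for $x\ge b$. The equality $a(t)=t^\alpha L(t)$ is understood for all sufficiently large $t$. For $r\in\mathbb R$, $\mathcal M_r$ is the class of (continuous) functions $u$ for which the (improper) integrals below converge and $\lim_{x\to\infty}x\int_x^\infty\frac{u(t)}{t^2}\,dt=r$. *)

theory Defs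
  imports "HOL-Analysis.Analysis"
begin

text \<open>
  Functions on a half-line are modelled as total functions on the reals of which only the values
  for large arguments matter. All functions are continuous where they are defined.
\<close>

definition Z0 :: "(real \<Rightarrow> real) set" where
  "Z0 = {\<epsilon>. (\<exists>b. continuous_on {b..} \<epsilon>) \<and> (\<epsilon> \<longlongrightarrow> 0) at_top}"

definition normalized_slowly_varying :: "(real \<Rightarrow> real) set" where
  "normalized_slowly_varying =
     {L. \<exists>h>0. \<exists>b>0. \<exists>\<epsilon>\<in>Z0. continuous_on {b..} \<epsilon> \<and>
           (\<forall>x\<ge>b. L x = h * exp (integral {b..x} (\<lambda>t. \<epsilon> t / t)))}"

text \<open>
  \<open>I x\<close> is the improper integral of \<open>u t / t\<^sup>2\<close> over \<open>[x, \<infinity>)\<close>. It is a limit of integrals over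
  bounded intervals, so absolute convergence is not required.
\<close>

definition M_class :: "real \<Rightarrow> (real \<Rightarrow> real) set" where
  "M_class r =
     {u. \<exists>b>0. continuous_on {b..} u \<and>
        (\<exists>I. (\<forall>x\<ge>b. ((\<lambda>X. integral {x..X} (\<lambda>t. u t / t\<^sup>2)) \<longlongrightarrow> I x) at_top) \<and>
             ((\<lambda>x. x * I x) \<longlongrightarrow> r) at_top)}"

text \<open>
  Solutions for curvature index 0. Derivatives are taken within \<open>[t0, \<infinity>)\<close>, hence are one-sided
  at \<open>t0\<close>; \<open>a'\<close>, \<open>a''\<close>, \<open>\<rho>'\<close> are uniquely determined there.
\<close>

definition flat_friedmann_solution ::
  "real \<Rightarrow> real \<Rightarrow> real \<Rightarrow> (real \<Rightarrow> real) \<Rightarrow> (real \<Rightarrow> real) \<Rightarrow> (real \<Rightarrow> real) \<Rightarrow> bool" where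
  "flat_friedmann_solution G c t0 a \<rho> p \<longleftrightarrow>
     (\<exists>a' a'' \<rho>'.
        continuous_on {t0..} a'' \<and> continuous_on {t0..} p \<and>
        (\<forall>t\<ge>t0.
           (a has_real_derivative a' t) (at t within {t0..}) \<and>
           (a' has_real_derivative a'' t) (at t within {t0..}) \<and>
           (\<rho> has_real_derivative \<rho>' t) (at t within {t0..}) \<and>
           (a' t / a t)\<^sup>2 = 8 * pi * G / 3 * \<rho> t \<and>
           a'' t / a t = - (4 * pi * G / 3) * (\<rho> t + 3 * p t / c\<^sup>2) \<and>
           \<rho>' t + 3 * (a' t / a t) * (\<rho> t + p t / c\<^sup>2) = 0))"

definition friedmann_mu ::
  "real \<Rightarrow> real \<Rightarrow> (real \<Rightarrow> real) \<Rightarrow> (real \<Rightarrow> real) \<Rightarrow> real \<Rightarrow> real" where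
  "friedmann_mu G c \<rho> p t = 4 * pi * G / 3 * t\<^sup>2 * (\<rho> t + 3 * p t / c\<^sup>2)"

end

theory Submission imports Defs begin

text \<open>
  Put \<open>y t = t * a' t / a t\<close>, the logarithmic derivative of \<open>a\<close> scaled by \<open>t\<close>. For
  \<open>a t = t powr \<alpha> * L t\<close> with \<open>L\<close> normalized slowly varying, \<open>y = \<alpha> + \<epsilon>\<close> with \<open>\<epsilon>\<close> vanishing at
  infinity, so \<open>y\<close> is eventually nonzero. Eliminating \<open>a''\<close> from the first two Friedmann equations
  gives \<open>p / (\<rho> * c\<^sup>2) = - 1 + 2 / (3 * y) + 2 / 3 * t * (1 / y)'\<close>, which has the required form
  with \<open>\<xi> = - \<zeta>\<close> and \<open>\<zeta> = 2 / (3 * y) - 2 / (3 * \<alpha>)\<close>.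
\<close>

text \<open>By the fundamental theorem of calculus, the exponent in the representation of
  \<open>L\<close> has derivative \<open>\<epsilon> t / t\<close>, so the \<open>\<epsilon>\<close>
  of that representation is \<open>t * L' t / L t\<close>.\<close>

lemma normalized_slowly_varying_log_derivative:
  assumes "L \<in> normalized_slowly_varying"
  obtains \<epsilon> where "(\<epsilon> \<longlongrightarrow> 0) at_top"
    and "\<forall>\<^sub>F t in at_top. L t > 0 \<and> (L has_real_derivative L t * \<epsilon> t / t) (at t)"
proof -
  from assms obtain h b \<epsilon> where h: "h > 0" and b: "b > 0" and \<epsilon>: "\<epsilon> \<in> Z0"
    and cont: "continuous_on {b..} \<epsilon>"
    and L: "\<And>x. x \<ge> b \<Longrightarrow> L x = h * exp (integral {b..x} (\<lambda>t. \<epsilon> t / t))"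
    unfolding normalized_slowly_varying_def by blast
  have deriv: "(L has_real_derivative L t * \<epsilon> t / t) (at t)" if t: "t > b" for t
  proof -
    \<comment> \<open>Integrating up to \<open>t + 1\<close> makes \<open>t\<close> an interior
      point, so the derivative within the interval is a two-sided one.\<close>
    have "continuous_on {b..t + 1} (\<lambda>t. \<epsilon> t / t)"
      using b by (intro continuous_intros continuous_on_subset[OF cont]) auto
    then have "((\<lambda>x. integral {b..x} (\<lambda>t. \<epsilon> t / t)) has_real_derivative \<epsilon> t / t)
        (at t within {b..t + 1})"
      using t by (intro integral_has_real_derivative) auto
    then have I: "((\<lambda>x. integral {b..x} (\<lambda>t. \<epsilon> t / t)) has_real_derivative \<epsilon> t / t) (at t)"
      using t by (simp add: at_within_Icc_at)
    have "((\<lambda>x. h * exp (integral {b..x} (\<lambda>t. \<epsilon> t / t))) has_real_derivative L t * \<epsilon> t / t) (at t)"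
      using t by (auto intro!: derivative_eq_intros I simp: L)
    then show ?thesis
    proof (rule has_field_derivative_transform_within_open[of _ _ _ "{b<..}"])
      show "\<And>x. x \<in> {b<..} \<Longrightarrow> h * exp (integral {b..x} (\<lambda>t. \<epsilon> t / t)) = L x"
        by (simp add: L)
    qed (use t in auto)
  qed
  have "\<forall>\<^sub>F t in at_top. L t > 0 \<and> (L has_real_derivative L t * \<epsilon> t / t) (at t)"
    using eventually_gt_at_top[of b] by eventually_elim (intro conjI deriv, simp_all add: L h)
  moreover have "(\<epsilon> \<longlongrightarrow> 0) at_top"
    using \<epsilon> by (simp add: Z0_def)
  ultimately show thesis
    using that by blast
qed

text \<open>Logarithmic derivatives of a product add up: \<open>t powr \<alpha>\<close> contributes
  exactly \<alpha>, and \<open>L\<close> contributes an \<open>\<epsilon> t\<close> that tends to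
  0.\<close>

lemma regularly_varying_log_derivative_tendsto:
  assumes L: "L \<in> normalized_slowly_varying"
    and a: "\<forall>\<^sub>F t in at_top. a t = t powr \<alpha> * L t"
    and a': "\<forall>\<^sub>F t in at_top. (a has_real_derivative a' t) (at t)"
  shows "((\<lambda>t. t * a' t / a t) \<longlongrightarrow> \<alpha>) at_top"
proof -
  obtain \<epsilon> where \<epsilon>: "(\<epsilon> \<longlongrightarrow> 0) at_top"
    and dL: "\<forall>\<^sub>F t in at_top. L t > 0 \<and> (L has_real_derivative L t * \<epsilon> t / t) (at t)"
    using L by (rule normalized_slowly_varying_log_derivative)
  from a obtain N where N: "\<And>t. t \<ge> N \<Longrightarrow> a t = t powr \<alpha> * L t"
    unfolding eventually_at_top_linorder by blast
  have "\<forall>\<^sub>F t in at_top. t * a' t / a t = \<alpha> + \<epsilon> t"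
    using dL a' eventually_gt_at_top[of N] eventually_gt_at_top[of 0]
  proof eventually_elim
    case (elim t)
    have "((\<lambda>s. s powr \<alpha> * L s) has_real_derivative
        \<alpha> * t powr (\<alpha> - 1) * L t + L t * \<epsilon> t / t * t powr \<alpha>) (at t)"
      using elim by (intro DERIV_mult has_real_derivative_powr) auto
    \<comment> \<open>The factorization of \<open>a\<close> holds on the whole open ray beyond
      \<open>N\<close>, so the derivative carries over to \<open>a\<close>; uniqueness then
      identifies it with \<open>a' t\<close>.\<close>
    then have "(a has_real_derivative
        \<alpha> * t powr (\<alpha> - 1) * L t + L t * \<epsilon> t / t * t powr \<alpha>) (at t)"
      by (rule has_field_derivative_transform_within_open[of _ _ _ "{N<..}"])
        (use elim N in auto)
    then have "a' t = \<alpha> * t powr (\<alpha> - 1) * L t + L t * \<epsilon> t / t * t powr \<alpha>"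
      using elim DERIV_unique by blast
    then show ?case
      using elim by (simp add: N powr_diff field_simps)
  qed
  moreover have "((\<lambda>t. \<alpha> + \<epsilon> t) \<longlongrightarrow> \<alpha>) at_top"
    using tendsto_add[OF tendsto_const \<epsilon>, of \<alpha>] by simp
  ultimately show ?thesis
    by (simp cong: tendsto_cong)
qed

text \<open>Pointwise algebra in the Hubble rate \<open>H = A' / A\<close>, where
  \<open>y = t * H\<close> and \<open>y'\<close> is the value that the quotient rule gives for its
  derivative. The first equation turns \<rho> into a multiple of \<open>H\<^sup>2\<close>, which is
  nonzero.\<close>

lemma flat_equation_of_state:
  fixes G c t A A' A'' \<rho> p y y' :: real
  assumes "G > 0" "c > 0" "t > 0" "A > 0" "A' \<noteq> 0"
    and \<rho>: "(A' / A)\<^sup>2 = 8 * pi * G / 3 * \<rho>"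
    and acc: "A'' / A = - (4 * pi * G / 3) * (\<rho> + 3 * p / c\<^sup>2)"
    and y: "y = t * A' / A"
    and y': "y' = A' / A + t * A'' / A - t * (A' / A)\<^sup>2"
  shows "p = (- 1 + 2 / (3 * y) - 2 / 3 * t * y' / y\<^sup>2) * \<rho> * c\<^sup>2"
proof -
  define H where "H = A' / A"
  have H: "H \<noteq> 0"
    using assms by (simp add: H_def)
  have \<rho>_eq: "\<rho> = 3 * H\<^sup>2 / (8 * pi * G)"
    using \<rho> \<open>G > 0\<close> by (simp add: H_def[symmetric] field_simps)
  have acc_eq: "A'' / A = - H\<^sup>2 / 2 - 4 * pi * G * p / c\<^sup>2"
    unfolding acc \<rho>_eq using \<open>G > 0\<close> \<open>c > 0\<close> by (simp add: field_simps)
  have y_eq: "y = t * H"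
    by (simp add: y H_def)
  \<comment> \<open>The flipped rule regroups \<open>t * A'' / A\<close> as
    \<open>t * (A'' / A)\<close>, so that \<open>acc_eq\<close> can rewrite it.\<close>
  have y'_eq: "y' = H + t * (- H\<^sup>2 / 2 - 4 * pi * G * p / c\<^sup>2) - t * H\<^sup>2"
    by (simp only: y' H_def acc_eq[unfolded H_def] flip: times_divide_eq_right)
  \<comment> \<open>The terms of \<open>y'\<close> in \<open>H\<close> and \<open>H\<^sup>2\<close>
    cancel \<open>2 / (3 * y)\<close> and \<open>- 1\<close>; only the pressure term survives, and
    it is \<open>p / (\<rho> * c\<^sup>2)\<close>.\<close>
  have "- 1 + 2 / (3 * y) - 2 / 3 * t * y' / y\<^sup>2 = 8 * pi * G * p / (3 * H\<^sup>2 * c\<^sup>2)"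
    unfolding y_eq y'_eq using H \<open>t > 0\<close> \<open>c > 0\<close>
    by (simp add: field_simps power2_eq_square)
  then show ?thesis
    using H \<open>G > 0\<close> \<open>c > 0\<close> by (simp add: \<rho>_eq)
qed

theorem corollary3p7:
  fixes G c t0 \<alpha> \<Gamma> w :: real
    and a \<rho> p L :: "real \<Rightarrow> real"
  assumes "G > 0" and "c > 0" and "t0 > 0"
    and "\<And>t. t \<ge> t0 \<Longrightarrow> a t > 0"
    and "flat_friedmann_solution G c t0 a \<rho> p"
    and "friedmann_mu G c \<rho> p \<in> M_class \<Gamma>" and "\<Gamma> < 1 / 4"
    and "\<alpha> \<noteq> 0" and "L \<in> normalized_slowly_varying"
    and "eventually (\<lambda>t. a t = t powr \<alpha> * L t) at_top"
    and "w = 2 / (3 * \<alpha>) - 1"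
  shows "\<exists>\<xi>\<in>Z0. \<exists>\<zeta>\<in>Z0. \<exists>w_hat.
           eventually (\<lambda>t. \<xi> differentiable (at t) \<and>
                           w_hat t = w - t * deriv \<xi> t + \<zeta> t \<and>
                           p t = w_hat t * \<rho> t * c\<^sup>2) at_top"
proof -
  from assms(5) obtain a' a'' \<rho>' where sol: "\<And>t. t \<ge> t0 \<Longrightarrow>
      (a has_real_derivative a' t) (at t within {t0..}) \<and>
      (a' has_real_derivative a'' t) (at t within {t0..}) \<and>
      (a' t / a t)\<^sup>2 = 8 * pi * G / 3 * \<rho> t \<and>
      a'' t / a t = - (4 * pi * G / 3) * (\<rho> t + 3 * p t / c\<^sup>2)"
    unfolding flat_friedmann_solution_def by blast
  have at: "at t within {t0..} = at t" if "t > t0" for t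
    by (rule at_within_interior) (simp add: that)
  have da: "(a has_real_derivative a' t) (at t)"
    and da': "(a' has_real_derivative a'' t) (at t)" if "t > t0" for t
    using sol[of t] at[OF that] that by auto
  define y where "y t = t * a' t / a t" for t
  define y' where "y' t = a' t / a t + t * a'' t / a t - t * (a' t / a t)\<^sup>2" for t
  have y_lim: "(y \<longlongrightarrow> \<alpha>) at_top"
    unfolding y_def
  proof (rule regularly_varying_log_derivative_tendsto[OF assms(9,10)])
    show "\<forall>\<^sub>F t in at_top. (a has_real_derivative a' t) (at t)"
      using eventually_gt_at_top[of t0] by eventually_elim (rule da)
  qed
  then have "\<forall>\<^sub>F t in at_top. y t \<noteq> 0"
    using tendsto_imp_eventually_ne \<open>\<alpha> \<noteq> 0\<close> by blast
  \<comment> \<open>Taking \<open>B\<close> strictly beyond \<open>t0\<close> makes all derivatives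
    two-sided on the closed ray from \<open>B\<close>.\<close>
  then obtain B where B: "B > t0" and y_nz: "\<And>t. t \<ge> B \<Longrightarrow> y t \<noteq> 0"
    unfolding eventually_at_top_linorder
    by (metis add.commute less_add_one max.bounded_iff max.cobounded2 order_less_le_trans)
  have dy: "(y has_real_derivative y' t) (at t)" if "t > t0" for t
    unfolding y_def[abs_def] y'_def using assms(4)[of t] that
    by (auto intro!: derivative_eq_intros da da' simp: field_simps power2_eq_square)
  \<comment> \<open>\<zeta> is the error made when \<alpha> replaces \<open>y t\<close> in
    \<open>w\<close>, so \<open>w + \<zeta> t = - 1 + 2 / (3 * y t)\<close>. With
    \<open>\<xi> = - \<zeta>\<close>, the term \<open>- t * deriv \<xi> t\<close> supplies the
    remaining summand, the one with \<open>y' t\<close>.\<close>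
  define \<zeta> where "\<zeta> t = 2 / (3 * y t) - 2 / (3 * \<alpha>)" for t
  define \<xi> where "\<xi> t = - \<zeta> t" for t
  have d\<xi>: "(\<xi> has_real_derivative 2 / 3 * y' t / (y t)\<^sup>2) (at t)" if "t \<ge> B" for t
    unfolding \<xi>_def[abs_def] \<zeta>_def using that B y_nz[OF that]
    by (auto intro!: derivative_eq_intros dy simp: field_simps power2_eq_square)
  have \<zeta>_lim: "(\<zeta> \<longlongrightarrow> 0) at_top"
    unfolding \<zeta>_def[abs_def] by (rule tendsto_eq_intros y_lim | simp add: \<open>\<alpha> \<noteq> 0\<close>)+
  have "continuous_on {B..} \<xi>"
    by (rule DERIV_continuous_on, rule DERIV_subset, rule d\<xi>) auto
  moreover have "(\<xi> \<longlongrightarrow> 0) at_top"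
    unfolding \<xi>_def[abs_def] using tendsto_minus[OF \<zeta>_lim] by simp
  ultimately have \<xi>_Z0: "\<xi> \<in> Z0"
    unfolding Z0_def by blast
  have "continuous_on {B..} \<zeta>"
    using continuous_on_minus[OF \<open>continuous_on {B..} \<xi>\<close>] by (simp add: \<xi>_def)
  then have \<zeta>_Z0: "\<zeta> \<in> Z0"
    using \<zeta>_lim unfolding Z0_def by blast
  \<comment> \<open>The reflexive middle conjunct is the defining equation of \<open>w_hat\<close>
    at its witness, which lets \<open>exI\<close> find that witness by unification.\<close>
  have "\<forall>\<^sub>F t in at_top. \<xi> differentiable (at t) \<and>
      w - t * deriv \<xi> t + \<zeta> t = w - t * deriv \<xi> t + \<zeta> t \<and>
      p t = (w - t * deriv \<xi> t + \<zeta> t) * \<rho> t * c\<^sup>2"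
    using eventually_ge_at_top[of B]
  proof eventually_elim
    case (elim t)
    have "w - t * deriv \<xi> t + \<zeta> t = - 1 + 2 / (3 * y t) - 2 / 3 * t * y' t / (y t)\<^sup>2"
      by (simp add: DERIV_imp_deriv[OF d\<xi>[OF elim]] \<open>w = _\<close> \<zeta>_def)
    moreover have "p t = (- 1 + 2 / (3 * y t) - 2 / 3 * t * y' t / (y t)\<^sup>2) * \<rho> t * c\<^sup>2"
    proof (rule flat_equation_of_state[OF \<open>G > 0\<close> \<open>c > 0\<close> _ _ _ _ _ y_def y'_def])
      show "a' t \<noteq> 0"
        using y_nz[OF elim] by (auto simp: y_def)
    qed (use elim B \<open>t0 > 0\<close> assms(4) sol[of t] in auto)
    ultimately show ?case
      using d\<xi>[OF elim] real_differentiable_def by auto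
  qed
  then show ?thesis
    using \<xi>_Z0 \<zeta>_Z0 by (intro bexI exI)
qed

end
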